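(* Let $E\subset \mathbb{F}_3^3$ be a nonempty subset. Then $E$ is spectral if and only if $E$ tiles $\mathbb{F}_3^3$ by translations.
   Context: For a prime $p$, $\mathbb{F}_p$ is the field with $p$ elements and $x\cdot a$ denotes the standard dot product on $\mathbb{F}_p^d$. A subset $E\subset\mathbb{F}_p^d$ is called spectral if there is a subset $A\subset\mathbb{F}_p^d$ (a spectrum of $E$) such that the family of functions $\chi_a(x)=e^{\frac{2\pi i}{p}x\cdot a}$, $a\in A$, restricted to $E$, is an orthogonal basis (indexed by $A$) of the complex vector space $L^2(E)$ of functions $E\to\mathbb{C}$ with inner product $\langle f,g\rangle=\sum_{x\in E}f(x)\overline{g(x)}$. A subset $E\subset\mathbb{F}_p^d$ tiles $\mathbb{F}_p^d$ by translations if there is a subset $A\subset\mathbb{F}_p^d$ such that $\sum_{a\in A}E(x-a)=1$ for all $x\in\mathbb{F}_p^d$, where $E(\cdot)$ is the indicator function of $E$. *)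

theory Defs
  imports
    "HOL-Analysis.Analysis"
    "HOL-Library.Function_Algebras"
    "Berlekamp_Zassenhaus.Finite_Field"
begin

text \<open>
  For \<open>'p :: prime_card\<close> with \<open>p = CARD('p)\<close>, the type \<open>'p mod_ring\<close> is the field of integers
  modulo \<open>p\<close>.
\<close>

definition dot_prod :: "'a::comm_ring ^ 'd \<Rightarrow> 'a ^ 'd \<Rightarrow> 'a" where
  "dot_prod x y = (\<Sum>i\<in>UNIV. x $ i * y $ i)"

text \<open>
  \<open>to_int_mod_ring\<close> picks the representative in \<open>{0..<p}\<close>; the value of the character does not
  depend on this choice.
\<close>

definition chi :: "'p::prime_card mod_ring ^ 'd \<Rightarrow> 'p mod_ring ^ 'd \<Rightarrow> complex" where
  "chi a x = exp (2 * of_real pi * \<i> / of_nat CARD('p) * of_int (to_int_mod_ring (dot_prod x a)))"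

global_interpretation cfun: vector_space "\<lambda>(c::complex) (f::'a \<Rightarrow> complex) x. c * f x"
  by unfold_locales (simp_all add: fun_eq_iff algebra_simps)

text \<open>
  Functions on \<open>E\<close> are represented by functions on the whole type that vanish outside \<open>E\<close>.
\<close>

definition L2 :: "'a set \<Rightarrow> ('a \<Rightarrow> complex) set" where
  "L2 E = {f. \<forall>x. x \<notin> E \<longrightarrow> f x = 0}"

definition L2_restrict :: "'a set \<Rightarrow> ('a \<Rightarrow> complex) \<Rightarrow> 'a \<Rightarrow> complex" where
  "L2_restrict E f = (\<lambda>x. if x \<in> E then f x else 0)"

definition L2_inner :: "'a set \<Rightarrow> ('a \<Rightarrow> complex) \<Rightarrow> ('a \<Rightarrow> complex) \<Rightarrow> complex" where
  "L2_inner E f g = (\<Sum>x\<in>E. f x * cnj (g x))"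

text \<open>
  The basis is an indexed family: distinct indices must give distinct basis vectors.
\<close>

definition orthogonal_basis :: "'a set \<Rightarrow> 'i set \<Rightarrow> ('i \<Rightarrow> 'a \<Rightarrow> complex) \<Rightarrow> bool" where
  "orthogonal_basis E A b \<longleftrightarrow>
     inj_on b A \<and> cfun.independent (b ` A) \<and> cfun.span (b ` A) = L2 E \<and>
     (\<forall>i\<in>A. \<forall>j\<in>A. i \<noteq> j \<longrightarrow> L2_inner E (b i) (b j) = 0)"

definition spectral :: "('p::prime_card mod_ring ^ 'd) set \<Rightarrow> bool" where
  "spectral E \<longleftrightarrow> (\<exists>A. orthogonal_basis E A (\<lambda>a. L2_restrict E (chi a)))"

definition tiles_by_translations :: "('p::prime_card mod_ring ^ 'd) set \<Rightarrow> bool" where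
  "tiles_by_translations E \<longleftrightarrow> (\<exists>A. \<forall>x. (\<Sum>a\<in>A. indicator E (x - a) :: nat) = 1)"

end

theory Submission
  imports Defs
begin

text \<open>
  Write \<open>fourier E m\<close> for the sum over \<open>E\<close> of the character with frequency \<open>m\<close>. Both properties of
  \<open>E\<close> are statements about the zeros of this function. A set \<open>A\<close> is a spectrum of \<open>E\<close> iff it has as
  many points as \<open>E\<close> and \<open>fourier E\<close> vanishes on all nonzero differences of \<open>A\<close>; and since the
  characters of \<open>A\<close> then form a square matrix that is unitary up to a factor, \<open>E\<close> is in turn a
  spectrum of \<open>A\<close> (\<open>spectral_imp_dual_pair\<close>). If \<open>A\<close> is a tiling complement of \<open>E\<close>, then at every
  nonzero frequency one of \<open>fourier E\<close>, \<open>fourier A\<close> vanishes (\<open>fourier_tiling\<close>), and no set other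
  than the empty set and the whole space has a transform vanishing at all nonzero frequencies
  (\<open>exists_fourier_neq_0\<close>). Over the field with three elements, \<open>fourier E m = 0\<close> means that the
  three planes \<open>x \<cdot> m = t\<close> contain equally many points of \<open>E\<close> (\<open>fourier_eq_0_iff\<close>).

  Tiling implies spectral. The size of \<open>E\<close> divides 27, and sizes 1 and 27 are clear. If \<open>E\<close> has
  three points, its complement \<open>A\<close> is a proper subset, so \<open>fourier A\<close> is nonzero at some \<open>m \<noteq> 0\<close>;
  there \<open>fourier E\<close> vanishes, and the line through \<open>m\<close> is a spectrum. If \<open>E\<close> has nine points,
  \<open>A\<close> has three; pick two of them, \<open>a\<close> and \<open>b\<close>. A frequency orthogonal to \<open>a - b\<close> does not separate
  them, so \<open>fourier A\<close> is nonzero there and \<open>fourier E\<close> is zero: the plane orthogonal to \<open>a - b\<close> is a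
  spectrum.

  Spectral implies tiling. Let \<open>A\<close> be a spectrum and \<open>E\<close> not the whole space. Some \<open>v \<noteq> 0\<close> has
  \<open>fourier A v \<noteq> 0\<close>, and as \<open>E\<close> is a spectrum of \<open>A\<close>, no two points of \<open>E\<close> differ by a multiple of
  \<open>v\<close>. So the translates of \<open>E\<close> along the line through \<open>v\<close> are disjoint, which gives at most nine
  points, and a tiling if there are exactly nine. If \<open>E\<close> has more than one point, then \<open>fourier E\<close>
  has a zero and 3 divides the size. Three points tile with a plane. Six points cannot occur: the
  form \<open>B v w = (\<Sum>x\<in>E. (x \<cdot> v) * (x \<cdot> w))\<close> takes the value 1 on the diagonal and \<open>- 1\<close> off it at
  any four of the vectors \<open>a - a0\<close> with \<open>a \<in> A\<close>, and this Gram matrix is invertible modulo 3, so these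
  four vectors would be independent in a space of dimension three.
\<close>

section \<open>Characters of the additive group\<close>

text \<open>
  The additive character of the prime field. It is a homomorphism although its definition
  goes through integer representatives, because the exponential has period \<open>2 * pi * \<i>\<close>.
\<close>

definition psi :: "'p::prime_card mod_ring \<Rightarrow> complex" where
  "psi t = exp (2 * of_real pi * \<i> / of_nat CARD('p) * of_int (to_int_mod_ring t))"

lemma chi_eq_psi: "chi a x = psi (dot_prod x a)"
  by (simp add: chi_def psi_def)

lemma psi_add: "psi (s + t) = psi s * psi t"
  for s t :: "'p::prime_card mod_ring"
proof -
  define z where "z = 2 * of_real pi * \<i> / of_nat CARD('p)"
  define k where "k = to_int_mod_ring s + to_int_mod_ring t"
  have p0: "(of_nat CARD('p) :: complex) \<noteq> 0" by simp
  have "k = k mod int CARD('p) + int CARD('p) * (k div int CARD('p))"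
    by simp
  then have "(of_int k :: complex)
      = of_int (k mod int CARD('p)) + of_nat CARD('p) * of_int (k div int CARD('p))"
    by (metis of_int_add of_int_mult of_int_of_nat_eq)
  then have "z * of_int k = z * of_int (k mod int CARD('p))
      + of_int (2 * (k div int CARD('p))) * pi * \<i>"
    using p0 by (simp add: z_def algebra_simps add_divide_distrib)
  then have "exp (z * of_int k) = exp (z * of_int (k mod int CARD('p)))"
    unfolding exp_eq by blast
  moreover have "exp (z * of_int k) = psi s * psi t"
    by (simp add: k_def z_def psi_def algebra_simps flip: exp_add)
  ultimately show ?thesis
    by (simp add: psi_def k_def z_def to_int_mod_ring_add)
qed

lemma psi_0 [simp]: "psi 0 = 1"
  by (simp add: psi_def zero_mod_ring.rep_eq to_int_mod_ring.rep_eq)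

lemma psi_eq_1_iff: "psi t = 1 \<longleftrightarrow> t = 0"
  for t :: "'p::prime_card mod_ring"
proof
  assume "psi t = 1"
  then obtain n :: int where "2 * of_real pi * \<i> / of_nat CARD('p) * of_int (to_int_mod_ring t)
      = of_int (2 * n) * pi * \<i>"
    using exp_eq[of _ 0] unfolding psi_def by auto
  then have "(of_int (to_int_mod_ring t) :: complex) = of_nat CARD('p) * of_int n"
    by (simp add: field_simps)
  then have k: "to_int_mod_ring t = int CARD('p) * n"
    by (metis of_int_eq_iff of_int_mult of_int_of_nat_eq)
  moreover have "to_int_mod_ring t \<in> {0..<int CARD('p)}"
    using range_to_int_mod_ring[where 'a = 'p] by blast
  ultimately have "to_int_mod_ring t = 0"
    by (metis atLeastLessThan_iff mod_mult_self1_is_0 mod_pos_pos_trivial)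
  then show "t = 0"
    by (metis of_int_mod_ring_hom.hom_zero of_int_mod_ring_to_int_mod_ring)
qed simp

lemma cnj_psi: "cnj (psi t) = psi (- t)"
proof -
  have "norm (psi t) = 1"
    by (simp add: psi_def norm_exp_eq_Re)
  then have "psi t * cnj (psi t) = 1"
    by (simp add: complex_norm_square[symmetric])
  moreover have "psi t * psi (- t) = 1"
    by (simp flip: psi_add)
  ultimately show ?thesis
    by (metis mult_cancel_left mult_zero_left zero_neq_one)
qed

lemma dot_prod_commute: "dot_prod x y = dot_prod y x"
  by (simp add: dot_prod_def mult.commute)

lemma dot_prod_simps [simp]:
  "dot_prod (x + y) a = dot_prod x a + dot_prod y a"
  "dot_prod (x - y) a = dot_prod x a - dot_prod y a"
  "dot_prod (- x) a = - dot_prod x a"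
  "dot_prod 0 a = 0"
  "dot_prod a (x + y) = dot_prod a x + dot_prod a y"
  "dot_prod a (x - y) = dot_prod a x - dot_prod a y"
  "dot_prod a (- x) = - dot_prod a x"
  "dot_prod a 0 = 0"
  "dot_prod (c *s x) a = c * dot_prod x a"
  "dot_prod a (c *s x) = c * dot_prod a x"
  by (simp_all add: dot_prod_def algebra_simps sum.distrib sum_subtractf sum_negf sum_distrib_left)

lemma dot_prod_sum_left: "dot_prod (\<Sum>i\<in>I. f i) a = (\<Sum>i\<in>I. dot_prod (f i) a)"
  by (induction I rule: infinite_finite_induct) simp_all

lemma exists_dot_prod_neq_0:
  fixes m :: "'a::comm_ring_1 ^ 'd"
  assumes "m \<noteq> 0"
  obtains y where "dot_prod y m \<noteq> 0"
proof -
  obtain i where "m $ i \<noteq> 0"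
    using assms by (auto simp: vec_eq_iff)
  moreover have "dot_prod (axis i 1) m = m $ i"
    by (simp add: dot_prod_def axis_def if_distrib if_distribR cong: if_cong)
  ultimately show ?thesis
    using that by metis
qed

lemma chi_sym: "chi a x = chi x a"
  by (simp add: chi_eq_psi dot_prod_commute)

lemma chi_simps [simp]: "chi 0 x = 1" "chi a 0 = 1"
  by (simp_all add: chi_eq_psi)

lemma chi_add: "chi a (x + y) = chi a x * chi a y" "chi (a + b) x = chi a x * chi b x"
  by (simp_all add: chi_eq_psi psi_add)

lemma cnj_chi: "cnj (chi a x) = chi (- a) x"
  by (simp add: chi_eq_psi cnj_psi)

lemma chi_mult_cnj: "chi a x * cnj (chi b x) = chi (a - b) x"
  by (simp add: cnj_chi flip: chi_add)

section \<open>The Fourier transform of a set\<close>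

definition fourier :: "('p::prime_card mod_ring ^ 'd) set \<Rightarrow> 'p mod_ring ^ 'd \<Rightarrow> complex" where
  "fourier E m = (\<Sum>x\<in>E. chi m x)"

lemma fourier_0 [simp]: "fourier E 0 = of_nat (card E)"
  by (simp add: fourier_def)

lemma fourier_uminus: "fourier E (- m) = cnj (fourier E m)"
  by (simp add: fourier_def cnj_chi)

text \<open>
  Shifting the summation variable by \<open>y\<close> multiplies the sum by \<open>chi m y\<close>, and \<open>y\<close> can be chosen
  such that this factor is not 1.
\<close>

lemma fourier_UNIV:
  fixes m :: "'p::prime_card mod_ring ^ 'd"
  assumes "m \<noteq> 0"
  shows "fourier UNIV m = 0"
proof -
  obtain y where y: "dot_prod y m \<noteq> 0"
    using exists_dot_prod_neq_0[OF assms] .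
  have "fourier UNIV m = (\<Sum>x\<in>UNIV. chi m (y + x))"
    unfolding fourier_def by (rule sum.reindex_bij_witness[of _ "\<lambda>x. y + x" "\<lambda>x. x - y"]) auto
  also have "\<dots> = chi m y * fourier UNIV m"
    by (simp add: chi_add fourier_def sum_distrib_left)
  finally show ?thesis
    using y by (auto simp: chi_eq_psi psi_eq_1_iff)
qed

lemma fourier_inversion:
  fixes E :: "('p::prime_card mod_ring ^ 'd) set"
  shows "(\<Sum>m\<in>UNIV. fourier E m * cnj (chi m y))
    = of_nat CARD('p mod_ring ^ 'd) * indicator E y"
proof -
  have "(\<Sum>m\<in>UNIV. fourier E m * cnj (chi m y)) = (\<Sum>m\<in>UNIV. \<Sum>x\<in>E. chi (x - y) m)"
    unfolding fourier_def sum_distrib_right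
    by (intro sum.cong refl) (metis chi_mult_cnj chi_sym)
  also have "\<dots> = (\<Sum>x\<in>E. fourier UNIV (x - y))"
    unfolding fourier_def by (rule sum.swap)
  also have "\<dots> = (\<Sum>x\<in>E. if x = y then of_nat CARD('p mod_ring ^ 'd) else 0)"
    by (intro sum.cong) (auto simp: fourier_UNIV)
  also have "\<dots> = of_nat CARD('p mod_ring ^ 'd) * indicator E y"
    by (simp add: indicator_def)
  finally show ?thesis .
qed

text \<open>
  If all nonzero frequencies vanished, the inversion formula would make the indicator of \<open>E\<close>
  constant.
\<close>

lemma exists_fourier_neq_0:
  fixes E :: "('p::prime_card mod_ring ^ 'd) set"
  assumes "E \<noteq> {}" "E \<noteq> UNIV"
  obtains m where "m \<noteq> 0" "fourier E m \<noteq> 0"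
proof -
  obtain y where y: "y \<notin> E"
    using assms by blast
  have "(\<Sum>m\<in>UNIV - {0}. fourier E m * cnj (chi m y)) + of_nat (card E) = 0"
    using fourier_inversion[of E y] y
    by (simp add: sum.remove[of UNIV 0] add.commute)
  moreover have "card E \<noteq> 0"
    using assms by simp
  ultimately have "(\<Sum>m\<in>UNIV - {0}. fourier E m * cnj (chi m y)) \<noteq> 0"
    by auto
  then show ?thesis
    using that by (metis (no_types, lifting) DiffE insertI1 mult_zero_left sum.neutral)
qed

section \<open>Spectra and zeros of the Fourier transform\<close>

text \<open>
  This turns orthogonality of characters on \<open>E\<close> into zeros of the transform of \<open>E\<close>.
\<close>

lemma fourier_diff: "fourier E (a - b) = L2_inner E (chi a) (chi b)"
  by (simp add: fourier_def L2_inner_def chi_mult_cnj)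

lemma L2_inner_restrict:
  "L2_inner E (L2_restrict E f) (L2_restrict E g) = L2_inner E f g"
  by (simp add: L2_inner_def L2_restrict_def)

lemma L2_inner_sum_left:
  "L2_inner E (\<Sum>i\<in>I. (\<lambda>x. c i * f i x)) g = (\<Sum>i\<in>I. c i * L2_inner E (f i) g)"
proof -
  have "(\<Sum>i\<in>I. (\<lambda>x. c i * f i x)) x = (\<Sum>i\<in>I. c i * f i x)" for x
    by (induction I rule: infinite_finite_induct) simp_all
  then show ?thesis
    unfolding L2_inner_def
    by (simp add: sum_distrib_right sum_distrib_left mult.assoc) (rule sum.swap)
qed

text \<open>
  The spanning property says more than orthogonality: expanding the point mass at \<open>y \<in> E\<close> in the
  orthogonal basis gives the coefficients \<open>cnj (chi a y) / card E\<close>, and evaluating this expansion at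
  \<open>x \<in> E\<close> gives \<open>fourier A (x - y) / card E\<close>. For \<open>x = y\<close> this yields the size of \<open>A\<close>, and for
  \<open>x \<noteq> y\<close> it makes \<open>E\<close> a spectrum of \<open>A\<close>.
\<close>

lemma spectral_imp_dual_pair:
  fixes E :: "('p::prime_card mod_ring ^ 'd) set"
  assumes "spectral E" "E \<noteq> {}"
  obtains A where "card A = card E"
    and "\<And>a b. a \<in> A \<Longrightarrow> b \<in> A \<Longrightarrow> a \<noteq> b \<Longrightarrow> fourier E (a - b) = 0"
    and "\<And>x y. x \<in> E \<Longrightarrow> y \<in> E \<Longrightarrow> x \<noteq> y \<Longrightarrow> fourier A (x - y) = 0"
proof -
  let ?b = "\<lambda>a. L2_restrict E (chi a)"
  obtain A where inj: "inj_on ?b A" and span: "cfun.span (?b ` A) = L2 E"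
    and orth: "\<And>a b. a \<in> A \<Longrightarrow> b \<in> A \<Longrightarrow> a \<noteq> b \<Longrightarrow> L2_inner E (?b a) (?b b) = 0"
    using assms(1) unfolding spectral_def orthogonal_basis_def by (elim exE conjE) simp
  have orth': "fourier E (a - b) = 0" if "a \<in> A" "b \<in> A" "a \<noteq> b" for a b
    using orth[OF that] by (simp add: L2_inner_restrict fourier_diff)
  have cardE: "of_nat (card E) \<noteq> (0 :: complex)"
    using assms(2) by simp
  have key: "fourier A (x - y) = (if x = y then of_nat (card E) else 0)"
    if x: "x \<in> E" and y: "y \<in> E" for x y
  proof -
    \<comment> \<open>the point mass at \<open>y\<close>, with coefficients \<open>u\<close> in the basis\<close>
    define d :: "'p mod_ring ^ 'd \<Rightarrow> complex" where "d = (\<lambda>z. if z = y then 1 else 0)"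
    have "d \<in> cfun.span (?b ` A)"
      using y unfolding span by (auto simp: L2_def d_def)
    then obtain u where "d = (\<Sum>f\<in>?b ` A. (\<lambda>z. u f * f z))"
      by (auto simp: cfun.span_finite)
    then have d: "d = (\<Sum>a\<in>A. (\<lambda>z. u (?b a) * ?b a z))"
      by (simp add: sum.reindex[OF inj])
    have u: "u (?b a) = cnj (chi a y) / of_nat (card E)" if a: "a \<in> A" for a
    proof -
      have "cnj (chi a y) = L2_inner E d (?b a)"
        using y by (simp add: L2_inner_def d_def L2_restrict_def if_distrib if_distribR cong: if_cong)
      also have "\<dots> = (\<Sum>b\<in>A. u (?b b) * fourier E (b - a))"
        by (subst d, subst L2_inner_sum_left) (simp add: L2_inner_restrict fourier_diff)
      also have "\<dots> = (\<Sum>b\<in>A. if b = a then u (?b a) * of_nat (card E) else 0)"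
        using orth' a by (intro sum.cong) auto
      also have "\<dots> = u (?b a) * of_nat (card E)"
        using a by simp
      finally show ?thesis
        using cardE by (simp add: field_simps)
    qed
    have "d x = (\<Sum>a\<in>A. u (?b a) * ?b a x)"
      by (subst d) (induction A rule: infinite_finite_induct, simp_all)
    also have "\<dots> = (\<Sum>a\<in>A. chi (x - y) a / of_nat (card E))"
    proof (intro sum.cong refl)
      fix a assume "a \<in> A"
      then have "u (?b a) * ?b a x = chi a x * cnj (chi a y) / of_nat (card E)"
        using x by (subst u) (simp_all add: L2_restrict_def)
      then show "u (?b a) * ?b a x = chi (x - y) a / of_nat (card E)"
        by (metis chi_mult_cnj chi_sym)
    qed
    also have "\<dots> = fourier A (x - y) / of_nat (card E)"
      by (simp add: fourier_def sum_divide_distrib)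
    finally show ?thesis
      using cardE by (auto simp: d_def field_simps)
  qed
  from assms(2) obtain x where "x \<in> E" by blast
  from key[OF this this] have "card A = card E" by simp
  then show ?thesis
    using that orth' key by metis
qed

text \<open>
  Orthogonal nonzero functions are independent, and independent functions span \<open>L2 E\<close> as soon as
  there are as many of them as point masses on \<open>E\<close>.
\<close>

lemma spectralI:
  fixes E A :: "('p::prime_card mod_ring ^ 'd) set"
  assumes "card A = card E" "E \<noteq> {}"
    and vanish: "\<And>a b. a \<in> A \<Longrightarrow> b \<in> A \<Longrightarrow> a \<noteq> b \<Longrightarrow> fourier E (a - b) = 0"
  shows "spectral E"
proof -
  let ?b = "\<lambda>a. L2_restrict E (chi a)"
  have inner: "L2_inner E (?b a) (?b b) = (if a = b then of_nat (card E) else 0)"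
    if "a \<in> A" "b \<in> A" for a b
    using vanish[OF that] by (simp add: L2_inner_restrict flip: fourier_diff)
  have cardE: "of_nat (card E) \<noteq> (0 :: complex)"
    using assms(2) by simp
  have inj: "inj_on ?b A"
  proof (rule inj_onI, rule ccontr)
    fix a b assume ab: "a \<in> A" "b \<in> A" "?b a = ?b b" "a \<noteq> b"
    then have "L2_inner E (?b a) (?b a) = 0"
      using inner[OF ab(1,2)] by simp
    then show False
      using inner[OF ab(1,1)] cardE by simp
  qed
  have indep: "cfun.independent (?b ` A)"
  proof (rule cfun.independent_if_scalars_zero)
    fix u f assume sum0: "(\<Sum>g\<in>?b ` A. (\<lambda>z. u g * g z)) = 0" and "f \<in> ?b ` A"
    then obtain a where a: "a \<in> A" "f = ?b a" by blast
    have "0 = L2_inner E (\<Sum>b\<in>A. (\<lambda>z. u (?b b) * ?b b z)) (?b a)"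
      using sum0 by (simp add: sum.reindex[OF inj] L2_inner_def)
    also have "\<dots> = (\<Sum>b\<in>A. if b = a then u (?b a) * of_nat (card E) else 0)"
      unfolding L2_inner_sum_left using a inner by (intro sum.cong) auto
    also have "\<dots> = u f * of_nat (card E)"
      using a by simp
    finally show "u f = 0"
      using cardE by simp
  qed simp
  \<comment> \<open>the point masses on \<open>E\<close>\<close>
  let ?D = "(\<lambda>y z. if z = y then 1 else 0 :: complex) ` E"
  have D: "f \<in> cfun.span ?D" if "f \<in> L2 E" for f
  proof -
    have "f = (\<Sum>y\<in>E. (\<lambda>z. f y * (if z = y then 1 else 0)))"
    proof
      fix z
      have "(\<Sum>y\<in>F. (\<lambda>z. f y * (if z = y then 1 else 0))) z = (if z \<in> F then f z else 0)"
        if "finite F" for F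
        using that by induction auto
      then show "f z = (\<Sum>y\<in>E. (\<lambda>z. f y * (if z = y then 1 else 0))) z"
        using \<open>f \<in> L2 E\<close> by (simp add: L2_def)
    qed
    also have "\<dots> \<in> cfun.span ?D"
      by (intro cfun.span_sum cfun.span_scale cfun.span_base) auto
    finally show ?thesis .
  qed
  have bL2: "?b ` A \<subseteq> L2 E"
    by (auto simp: L2_def L2_restrict_def)
  have "cfun.span (?b ` A) = L2 E"
  proof
    have "cfun.subspace (L2 E)"
      by (auto simp: cfun.subspace_def L2_def)
    then show "cfun.span (?b ` A) \<subseteq> L2 E"
      using bL2 by (rule cfun.span_minimal[rotated])
    show "L2 E \<subseteq> cfun.span (?b ` A)"
    proof (rule subsetI, rule ccontr)
      fix f assume f: "f \<in> L2 E" "f \<notin> cfun.span (?b ` A)"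
      then have "cfun.independent (insert f (?b ` A))"
        using indep by (simp add: cfun.independent_insertI)
      moreover have "insert f (?b ` A) \<subseteq> cfun.span ?D"
        using D f bL2 by blast
      ultimately have "card (insert f (?b ` A)) \<le> card ?D"
        by (intro conjunct2[OF cfun.independent_span_bound]) simp_all
      also have "\<dots> \<le> card E"
        by (simp add: card_image_le)
      finally show False
        using f(2) cfun.span_base[of f "?b ` A"] assms(1)
        by (simp add: card_image[OF inj] card_insert_if split: if_splits)
    qed
  qed
  then show ?thesis
    unfolding spectral_def orthogonal_basis_def using inj indep inner by (intro exI[of _ A]) simp
qed

section \<open>Tilings, packings and their Fourier transforms\<close>

lemma sum_indicator_translates:
  fixes E A :: "('a::{finite,ab_group_add}) set"
  shows "(\<Sum>a\<in>A. indicator E (x - a) :: nat) = card {a\<in>A. x - a \<in> E}"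
  by (simp add: indicator_def sum.If_cases Int_def)

lemma inj_on_add_Times:
  fixes E A :: "'a::ab_group_add set"
  assumes uniq: "\<And>x y a b. x \<in> E \<Longrightarrow> y \<in> E \<Longrightarrow> a \<in> A \<Longrightarrow> b \<in> A \<Longrightarrow> x + a = y + b \<Longrightarrow> a = b"
  shows "inj_on (\<lambda>(x, a). x + a) (E \<times> A)"
proof (rule inj_onI, clarify)
  fix x a y b assume xy: "x \<in> E" "y \<in> E" "a \<in> A" "b \<in> A" "x + a = y + b"
  then have "a = b" by (rule uniq)
  with xy show "x = y \<and> a = b" by simp
qed

text \<open>
  When the sizes match, disjointness of the translates already forces them to cover: an injection
  of \<open>E \<times> A\<close> into a space of the same size is onto.
\<close>

lemma tilesI:
  fixes E A :: "('p::prime_card mod_ring ^ 'd) set"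
  assumes uniq: "\<And>x y a b. x \<in> E \<Longrightarrow> y \<in> E \<Longrightarrow> a \<in> A \<Longrightarrow> b \<in> A \<Longrightarrow> x + a = y + b \<Longrightarrow> a = b"
    and card: "card E * card A = CARD('p mod_ring ^ 'd)"
  shows "tiles_by_translations E"
proof -
  let ?f = "\<lambda>(x, a). x + a"
  have "inj_on ?f (E \<times> A)"
    using uniq by (rule inj_on_add_Times)
  then have "card (?f ` (E \<times> A)) = CARD('p mod_ring ^ 'd)"
    using card by (simp add: card_image card_cartesian_product)
  then have surj: "?f ` (E \<times> A) = UNIV"
    by (intro card_subset_eq) simp_all
  have "card {a\<in>A. z - a \<in> E} = 1" for z
  proof -
    have "z \<in> ?f ` (E \<times> A)"
      using surj by simp
    then obtain x a where xa: "x \<in> E" "a \<in> A" "z = x + a"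
      by auto
    have "b = a" if "b \<in> A" "z - b \<in> E" for b
      using uniq[of "z - b" x b a] xa that by simp
    then have "{a\<in>A. z - a \<in> E} = {a}"
      using xa by auto
    then show ?thesis by simp
  qed
  then show ?thesis
    unfolding tiles_by_translations_def sum_indicator_translates by blast
qed

text \<open>
  A tiling writes the indicator of the whole space as the convolution of the indicators of \<open>E\<close> and
  \<open>A\<close>, and the Fourier transform turns convolution into a product.
\<close>

lemma fourier_tiling:
  fixes E A :: "('p::prime_card mod_ring ^ 'd) set"
  assumes tile: "\<And>x. (\<Sum>a\<in>A. indicator E (x - a) :: nat) = 1"
  shows "fourier E m * fourier A m = fourier UNIV m"
proof -
  have "fourier UNIV m = (\<Sum>x\<in>UNIV. chi m x * of_nat (\<Sum>a\<in>A. indicator E (x - a)))"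
    by (simp add: tile fourier_def)
  also have "\<dots> = (\<Sum>x\<in>UNIV. \<Sum>a\<in>A. chi m x * indicator E (x - a))"
    unfolding of_nat_sum sum_distrib_left by (simp add: indicator_def)
  also have "\<dots> = (\<Sum>a\<in>A. \<Sum>x\<in>UNIV. chi m x * indicator E (x - a))"
    by (rule sum.swap)
  also have "\<dots> = (\<Sum>a\<in>A. \<Sum>x\<in>UNIV. chi m (x + a) * indicator E x)"
  proof (rule sum.cong[OF refl])
    fix a assume "a \<in> A"
    show "(\<Sum>x\<in>UNIV. chi m x * indicator E (x - a)) = (\<Sum>x\<in>UNIV. chi m (x + a) * indicator E x)"
      by (rule sum.reindex_bij_witness[of _ "\<lambda>x. x + a" "\<lambda>x. x - a"]) auto
  qed
  also have "\<dots> = (\<Sum>a\<in>A. fourier E m * chi m a)"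
    by (intro sum.cong refl)
      (simp add: fourier_def chi_add sum_distrib_right indicator_def if_distrib sum.If_cases cong: if_cong)
  also have "\<dots> = fourier E m * fourier A m"
    unfolding sum_distrib_left[symmetric] fourier_def[of A] ..
  finally show ?thesis ..
qed

text \<open>
  The product formula at frequency 0.
\<close>

lemma card_tiling:
  fixes E A :: "('p::prime_card mod_ring ^ 'd) set"
  assumes tile: "\<And>x. (\<Sum>a\<in>A. indicator E (x - a) :: nat) = 1"
  shows "card E * card A = CARD('p mod_ring ^ 'd)"
proof -
  have "of_nat (card E * card A) = (of_nat CARD('p mod_ring ^ 'd) :: complex)"
    using fourier_tiling[OF tile, of 0] by (simp del: CARD_vec)
  then show ?thesis
    unfolding of_nat_eq_iff .
qed

definition line :: "'a::field ^ 'd \<Rightarrow> ('a ^ 'd) set" where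
  "line v = range (\<lambda>c. c *s v)"

lemma card_line:
  fixes v :: "'p::prime_card mod_ring ^ 'd"
  assumes "v \<noteq> 0"
  shows "card (line v) = CARD('p)"
proof -
  have "inj (\<lambda>c. c *s v)"
    using assms by (auto intro: injI)
  then show ?thesis
    by (simp add: line_def card_image)
qed

lemma diff_in_line:
  assumes "a \<in> line v" "b \<in> line v" "a \<noteq> b"
  obtains c where "c \<noteq> 0" "a - b = c *s v"
proof -
  obtain s t where "a = s *s v" "b = t *s v"
    using assms by (auto simp: line_def)
  then have "s - t \<noteq> 0" "a - b = (s - t) *s v"
    using assms(3) by (auto simp: vector_sub_rdistrib)
  then show ?thesis using that by blast
qed

text \<open>
  A set without two points in direction \<open>v\<close> meets each of the parallels to \<open>v\<close> at most once, so its
  translates by the multiples of \<open>v\<close> are disjoint.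
\<close>

lemma line_packing:
  fixes E :: "('p::prime_card mod_ring ^ 'd) set"
  assumes v: "v \<noteq> 0"
    and avoid: "\<And>x y c. x \<in> E \<Longrightarrow> y \<in> E \<Longrightarrow> c \<noteq> 0 \<Longrightarrow> x - y \<noteq> c *s v"
  shows "card E * CARD('p) \<le> CARD('p mod_ring ^ 'd)"
    and "card E * CARD('p) = CARD('p mod_ring ^ 'd) \<Longrightarrow> tiles_by_translations E"
proof -
  have uniq: "a = b" if x: "x \<in> E" and y: "y \<in> E" and a: "a \<in> line v" and b: "b \<in> line v"
    and eq: "x + a = y + b" for x y a b
  proof (rule ccontr)
    assume "a \<noteq> b"
    then obtain c where "c \<noteq> 0" "b - a = c *s v"
      using diff_in_line[OF b a] by metis
    moreover have "x - y = b - a"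
      using eq by (simp add: algebra_simps)
    ultimately show False
      using avoid[OF x y] by simp
  qed
  let ?f = "\<lambda>(x, a). x + a"
  have "inj_on ?f (E \<times> line v)"
    using uniq by (rule inj_on_add_Times)
  then have "card (E \<times> line v) \<le> CARD('p mod_ring ^ 'd)"
    by (intro card_inj_on_le[of ?f]) simp_all
  then show "card E * CARD('p) \<le> CARD('p mod_ring ^ 'd)"
    by (simp add: card_cartesian_product card_line[OF v] del: CARD_vec)
  show "tiles_by_translations E" if "card E * CARD('p) = CARD('p mod_ring ^ 'd)"
    using uniq that by (intro tilesI[of E "line v"]) (simp_all add: card_line[OF v] del: CARD_vec)
qed

section \<open>The field with three elements\<close>

lemma three_eq_0:
  assumes "CARD('p::prime_card) = 3"
  shows "(3 :: 'p mod_ring) = 0"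
  using of_nat_card_eq_0[where 'a = 'p] assms by simp

lemma one_neq_minus_one:
  assumes "CARD('p::prime_card) = 3"
  shows "(1 :: 'p mod_ring) \<noteq> - 1"
proof
  assume "(1 :: 'p mod_ring) = - 1"
  then have "of_nat 2 = (0 :: 'p mod_ring)"
    by (metis add.left_inverse of_nat_numeral one_add_one)
  from of_nat_0_mod_ring_dvd[OF this] show False
    using assms by simp
qed

lemma UNIV_three:
  assumes "CARD('p::prime_card) = 3"
  shows "(UNIV :: 'p mod_ring set) = {0, 1, - 1}"
proof (rule card_subset_eq[symmetric])
  have "(1 :: 'p mod_ring) \<noteq> - 1"
    using assms by (rule one_neq_minus_one)
  then show "card {0, 1, - 1 :: 'p mod_ring} = card (UNIV :: 'p mod_ring set)"
    using assms by simp
qed simp_all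

text \<open>
  The only nonzero scalars are 1 and \<open>- 1\<close>, and the latter conjugates the transform. The zeros
  thus depend only on the direction of the frequency.
\<close>

lemma fourier_scale:
  fixes m :: "'p::prime_card mod_ring ^ 'd"
  assumes "CARD('p) = 3" "c \<noteq> 0"
  shows "fourier E (c *s m) = 0 \<longleftrightarrow> fourier E m = 0"
proof -
  have "c = 1 \<or> c = - 1"
    using UNIV_three[OF assms(1)] assms(2) by blast
  then have "c *s m = m \<or> c *s m = - m"
    by auto
  then show ?thesis
    by (auto simp: fourier_uminus)
qed

abbreviation level :: "('p::prime_card mod_ring ^ 'd) set \<Rightarrow> 'p mod_ring ^ 'd \<Rightarrow> 'p mod_ring \<Rightarrow> nat" where
  "level E m t \<equiv> card {x\<in>E. dot_prod x m = t}"

lemma sum_by_level: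
  fixes h :: "'p::prime_card mod_ring \<Rightarrow> 'b::comm_semiring_1"
  assumes "CARD('p) = 3"
  shows "(\<Sum>x\<in>E. h (dot_prod x m))
    = of_nat (level E m 0) * h 0 + of_nat (level E m 1) * h 1 + of_nat (level E m (- 1)) * h (- 1)"
proof -
  have "(\<Sum>x\<in>E. h (dot_prod x m)) = (\<Sum>t\<in>UNIV. \<Sum>x\<in>{x\<in>E. dot_prod x m = t}. h (dot_prod x m))"
    by (rule sum.group[symmetric]) simp_all
  also have "\<dots> = (\<Sum>t\<in>UNIV. of_nat (level E m t) * h t)"
    by simp
  also have "\<dots> = of_nat (level E m 0) * h 0 + of_nat (level E m 1) * h 1 + of_nat (level E m (- 1)) * h (- 1)"
    using one_neq_minus_one[OF assms] by (simp add: UNIV_three[OF assms] add.assoc)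
  finally show ?thesis .
qed

text \<open>
  With \<open>w\<close> a primitive cube root of unity, \<open>fourier E m\<close> is \<open>n0 + n1 * w + n2 * w\<^sup>2\<close> for the three level
  counts. Eliminating \<open>w\<^sup>2 = - 1 - w\<close> leaves real coefficients with respect to 1 and \<open>w\<close>, which vanish
  separately because \<open>w\<close> is not real.
\<close>

lemma fourier_eq_0_iff:
  fixes m :: "'p::prime_card mod_ring ^ 'd"
  assumes three: "CARD('p) = 3"
  shows "fourier E m = 0 \<longleftrightarrow> (\<forall>t. 3 * level E m t = card E)"
proof -
  define w where "w = psi (1 :: 'p mod_ring)"
  have "(1 :: 'p mod_ring) + 1 = - 1"
    using three_eq_0[OF three] by (simp add: eq_neg_iff_add_eq_0)
  then have w2: "psi (- 1 :: 'p mod_ring) = w * w"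
    by (metis psi_add w_def)
  have "w * w * w = 1"
    using w2 by (metis add.left_inverse psi_0 psi_add w_def)
  moreover have "w \<noteq> 1"
    by (simp add: w_def psi_eq_1_iff)
  moreover have "w * w * w - 1 = (w - 1) * (w * w + w + 1)"
    by (simp add: algebra_simps)
  ultimately have "w * w + w + 1 = 0"
    by simp
  moreover have "w * w = (w * w + w + 1) - 1 - w"
    by simp
  ultimately have w: "w * w = - 1 - w"
    by simp
  have "Im w \<noteq> 0"
  proof
    assume "Im w = 0"
    then have "cnj w = w"
      by (simp add: complex_eq_iff)
    then have "w * w = w"
      using w2 cnj_psi[of "1 :: 'p mod_ring"] by (simp add: w_def)
    then show False
      using \<open>w \<noteq> 1\<close> \<open>w * w * w = 1\<close> by auto
  qed
  have card: "card E = level E m 0 + level E m 1 + level E m (- 1)"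
    using sum_by_level[OF three, of "\<lambda>_. 1 :: nat" m E] by simp
  have "fourier E m = of_nat (level E m 0) + of_nat (level E m 1) * w + of_nat (level E m (- 1)) * (- 1 - w)"
    using sum_by_level[OF three, of psi m E] by (simp add: fourier_def chi_eq_psi w2 w flip: w_def)
  then have "fourier E m = of_real (real (level E m 0) - real (level E m (- 1)))
      + of_real (real (level E m 1) - real (level E m (- 1))) * w"
    by (simp add: algebra_simps)
  then have "fourier E m = 0 \<longleftrightarrow> level E m 0 = level E m (- 1) \<and> level E m 1 = level E m (- 1)"
    using \<open>Im w \<noteq> 0\<close> by (auto simp: complex_eq_iff)
  also have "\<dots> \<longleftrightarrow> (\<forall>t\<in>UNIV. 3 * level E m t = card E)"
    unfolding UNIV_three[OF three] card by auto
  finally show ?thesis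
    by simp
qed

section \<open>Exclusion of spectral sets with six points\<close>

text \<open>
  The Gram matrix is \<open>2 * 1 - J = - (1 + J)\<close> modulo 3, where \<open>J\<close> is the matrix with all entries 1. Up to sign
  its determinant is \<open>card S + 1\<close>, and a nonsingular Gram matrix forces independence.
\<close>

lemma independent_if_gram:
  fixes S :: "('p::prime_card mod_ring ^ 'd) set"
  assumes three: "CARD('p) = 3"
    and diag: "\<And>v. v \<in> S \<Longrightarrow> (\<Sum>x\<in>E. dot_prod x v * dot_prod x v) = 1"
    and offdiag: "\<And>v w. v \<in> S \<Longrightarrow> w \<in> S \<Longrightarrow> v \<noteq> w \<Longrightarrow> (\<Sum>x\<in>E. dot_prod x v * dot_prod x w) = - 1"
    and card: "of_nat (card S) + 1 \<noteq> (0 :: 'p mod_ring)"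
  shows "vec.independent S"
proof -
  have three0: "(3 :: 'p mod_ring) = 0"
    using three by (rule three_eq_0)
  show ?thesis
  proof (rule vec.independent_if_scalars_zero)
    fix u w assume sum0: "(\<Sum>v\<in>S. u v *s v) = 0" and "w \<in> S"
    define T where "T = (\<Sum>v\<in>S. u v)"
    \<comment> \<open>pairing the linear relation with \<open>w\<close>\<close>
    have uT: "u w = 2 * T" if w: "w \<in> S" for w
    proof -
      have "0 = (\<Sum>x\<in>E. dot_prod x (\<Sum>v\<in>S. u v *s v) * dot_prod x w)"
        unfolding sum0 by simp
      also have "\<dots> = (\<Sum>x\<in>E. \<Sum>v\<in>S. u v * (dot_prod x v * dot_prod x w))"
        by (simp add: dot_prod_commute[of _ "sum _ _"] dot_prod_sum_left sum_distrib_right)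
          (simp add: dot_prod_commute mult_ac)
      also have "\<dots> = (\<Sum>v\<in>S. u v * (\<Sum>x\<in>E. dot_prod x v * dot_prod x w))"
        unfolding sum_distrib_left by (rule sum.swap)
      also have "\<dots> = u w + (\<Sum>v\<in>S - {w}. - u v)"
        using w by (subst sum.remove[of _ w]) (auto simp: diag offdiag intro!: sum.cong)
      also have "\<dots> = 2 * u w - T"
        using w by (simp add: T_def sum.remove[of S w] sum_negf)
      finally have zero: "2 * u w - T = 0" ..
      have "u w = 2 * T + 2 * (2 * u w - T) - 3 * u w"
        by (simp add: algebra_simps)
      also have "\<dots> = 2 * T"
        unfolding zero three0 by simp
      finally show ?thesis .
    qed
    have "T = (\<Sum>v\<in>S. 2 * T)"
      using uT T_def by (metis (no_types, lifting) sum.cong)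
    then have "T = 2 * of_nat (card S) * T"
      by (simp add: mult_ac)
    moreover have "of_nat (card S) * T + T
        = 3 * (of_nat (card S) * T) + (T - 2 * of_nat (card S) * T)"
      by (simp add: algebra_simps)
    ultimately have "of_nat (card S) * T + T = 0"
      unfolding three0 by (metis add_0 diff_self mult_zero_left)
    then have "(of_nat (card S) + 1) * T = 0"
      by (simp add: algebra_simps)
    then have "T = 0"
      using card by simp
    then show "u w = 0"
      using uT[OF \<open>w \<in> S\<close>] by simp
  qed simp
qed

text \<open>
  Put the origin at \<open>a0 \<in> A\<close> and consider the form \<open>?q v w = (\<Sum>x\<in>E. (x \<cdot> v) * (x \<cdot> w))\<close>. A zero \<open>c\<close> of \<open>fourier E\<close>
  spreads the six points evenly, so \<open>?q c c = 2 * (0 + 1 + 1) = 1\<close> modulo 3. This applies to the vectors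
  \<open>a - a0\<close> and to their differences, and polarisation gives \<open>- 1\<close> off the diagonal. Four such vectors
  would be independent.
\<close>

lemma six_point_vanishing_differences:
  fixes E A :: "('p::prime_card mod_ring ^ 3) set"
  assumes three: "CARD('p) = 3" and E: "card E = 6"
    and vanish: "\<And>a b. a \<in> A \<Longrightarrow> b \<in> A \<Longrightarrow> a \<noteq> b \<Longrightarrow> fourier E (a - b) = 0"
  shows "card A < 5"
proof (rule ccontr)
  assume "\<not> card A < 5"
  moreover from this obtain a0 where a0: "a0 \<in> A"
    by fastforce
  ultimately have A: "4 \<le> card (A - {a0})"
    by (simp add: card_Diff_singleton)
  obtain B where B: "B \<subseteq> A - {a0}" "card B = 4"
    using obtain_subset_with_card_n[OF A] by metis
  let ?S = "(\<lambda>a. a - a0) ` B"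
  have three0: "(3 :: 'p mod_ring) = 0"
    using three by (rule three_eq_0)
  let ?q = "\<lambda>v w. \<Sum>x\<in>E. dot_prod x v * dot_prod x w"
  have q1: "?q c c = 1" if "fourier E c = 0" for c
  proof -
    have "level E c t = 2" for t
      using that E fourier_eq_0_iff[OF three, of E c] by simp
    then have "?q c c = 4"
      using sum_by_level[OF three, of "\<lambda>t. t * t" c E] by simp
    also have "\<dots> = 3 + 1"
      by simp
    finally show ?thesis
      unfolding three0 by simp
  qed
  have diag: "?q v v = 1" if "v \<in> ?S" for v
    using that B a0 by (auto intro!: q1 vanish)
  have "?q v w = - 1" if vw: "v \<in> ?S" "w \<in> ?S" "v \<noteq> w" for v w
  proof -
    obtain a b where ab: "a \<in> B" "b \<in> B" "v = a - a0" "w = b - a0"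
      using vw by blast
    then have "fourier E (a - b) = 0"
      using vw(3) B by (intro vanish) auto
    then have "fourier E (v - w) = 0"
      using ab by simp
    then have "?q (v - w) (v - w) = 1"
      by (rule q1)
    moreover have "?q (v - w) (v - w) = ?q v v - 2 * ?q v w + ?q w w"
      by (simp add: algebra_simps sum.distrib sum_subtractf sum_distrib_left)
    ultimately have "?q v v - 2 * ?q v w + ?q w w = 1"
      by simp
    then have "1 - 2 * ?q v w + 1 = 1"
      unfolding diag[OF vw(1)] diag[OF vw(2)] .
    moreover have "s = - 1" if "1 - 2 * s + 1 = 1" for s :: "'p mod_ring"
    proof -
      have "s = (1 - 2 * s + 1) - 1 - 1 + 3 * s"
        by (simp add: algebra_simps)
      then show ?thesis
        unfolding that three0 by simp
    qed
    ultimately show ?thesis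
      by blast
  qed
  moreover have S4: "card ?S = 4"
    using B(2) by (simp add: card_image)
  moreover have "(4 :: 'p mod_ring) + 1 \<noteq> 0"
  proof -
    have "(4 :: 'p mod_ring) + 1 = 3 * 2 - 1"
      by simp
    also have "\<dots> = - 1"
      unfolding three0 by simp
    finally show ?thesis
      by (simp only: neg_equal_0_iff_equal one_neq_zero not_False_eq_True)
  qed
  ultimately have "vec.independent ?S"
    using diag by (intro independent_if_gram[OF three, of ?S E]) simp_all
  then have "card ?S \<le> vec.dim (UNIV :: ('p mod_ring ^ 3) set)"
    by (intro vec.independent_card_le_dim) simp_all
  also have "\<dots> = 3"
    by (simp only: vec_dim_card) simp
  finally show False
    using S4 by simp
qed

section \<open>The equivalence in dimension three\<close>

lemma card_three_dim:
  assumes "CARD('p::prime_card) = 3"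
  shows "CARD('p mod_ring ^ 3) = 27"
  using assms by simp

text \<open>
  Each plane \<open>x \<cdot> m = t\<close> contains one point of \<open>E\<close>, so the plane \<open>x \<cdot> m = 0\<close> is a tiling complement.
\<close>

lemma tiles_if_3_points:
  fixes E :: "('p::prime_card mod_ring ^ 'd) set"
  assumes three: "CARD('p) = 3" and "card E = 3" "fourier E m = 0"
  shows "tiles_by_translations E"
proof -
  let ?A = "{a. dot_prod a m = 0}"
  have "card {a\<in>?A. x - a \<in> E} = 1" for x
  proof -
    have "bij_betw (\<lambda>a. x - a) {a\<in>?A. x - a \<in> E} {e\<in>E. dot_prod e m = dot_prod x m}"
      by (rule bij_betwI[where g = "\<lambda>e. x - e"]) auto
    then have "card {a\<in>?A. x - a \<in> E} = level E m (dot_prod x m)"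
      by (rule bij_betw_same_card)
    moreover have "3 * level E m (dot_prod x m) = 3"
      using assms fourier_eq_0_iff[OF three, of E m] by simp
    ultimately show ?thesis by simp
  qed
  then show ?thesis
    unfolding tiles_by_translations_def sum_indicator_translates by blast
qed

text \<open>
  Unless \<open>E\<close> is the whole space, duality with the spectrum gives a direction \<open>v\<close> in which no two
  points of \<open>E\<close> differ, hence at most nine points; equidistribution leaves the sizes 1, 3, 6 and 9.
\<close>

lemma tiles_if_spectral:
  fixes E :: "('p::prime_card mod_ring ^ 3) set"
  assumes three: "CARD('p) = 3" and "E \<noteq> {}" and "spectral E"
  shows "tiles_by_translations E"
proof -
  obtain A where cardA: "card A = card E"
    and vanishE: "\<And>a b. a \<in> A \<Longrightarrow> b \<in> A \<Longrightarrow> a \<noteq> b \<Longrightarrow> fourier E (a - b) = 0"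
    and vanishA: "\<And>x y. x \<in> E \<Longrightarrow> y \<in> E \<Longrightarrow> x \<noteq> y \<Longrightarrow> fourier A (x - y) = 0"
    using spectral_imp_dual_pair[OF assms(3,2)] by metis
  have E0: "card E > 0"
    using assms(2) by (simp add: card_gt_0_iff)
  show ?thesis
  proof (cases "E = UNIV")
    case True
    then show ?thesis
      by (intro tilesI[of E "{0}"]) simp_all
  next
    case False
    have "A \<noteq> {}"
      using cardA E0 by auto
    moreover have "A \<noteq> UNIV"
      using False cardA by (metis card_subset_eq finite subset_UNIV)
    ultimately obtain v where v: "v \<noteq> 0" "fourier A v \<noteq> 0"
      by (rule exists_fourier_neq_0)
    have avoid: "x - y \<noteq> c *s v" if "x \<in> E" "y \<in> E" "c \<noteq> 0" for x y c
    proof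
      assume xy: "x - y = c *s v"
      then have "x \<noteq> y"
        using v(1) that(3) by auto
      then have "fourier A (c *s v) = 0"
        using vanishA[OF that(1,2)] xy by simp
      then show False
        using v(2) fourier_scale[OF three that(3)] by blast
    qed
    have "card E * 3 \<le> 27"
      using line_packing(1)[OF v(1) avoid] three card_three_dim[OF three] by simp
    consider "card E = 1" | m where "fourier E m = 0"
    proof (cases "card E = 1")
      case False
      then obtain a b where "a \<in> A" "b \<in> A" "a \<noteq> b"
        using E0 cardA card_le_Suc0_iff_eq[of A] by fastforce
      then show ?thesis
        using that vanishE by blast
    qed
    then show ?thesis
    proof cases
      case 1
      then show ?thesis
        using card_three_dim[OF three]
        by (intro tilesI[of E UNIV]) (auto simp: card_1_singleton_iff)
    next
      case (2 m)
      then have "3 * level E m 0 = card E"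
        using fourier_eq_0_iff[OF three, of E m] by blast
      with \<open>card E * 3 \<le> 27\<close> E0 have "card E = 3 \<or> card E = 6 \<or> card E = 9"
        by arith
      then consider "card E = 3" | "card E = 6" | "card E = 9"
        by blast
      then show ?thesis
      proof cases
        case 1
        then show ?thesis
          using tiles_if_3_points[OF three] \<open>fourier E m = 0\<close> by blast
      next
        case 2
        then show ?thesis
          using six_point_vanishing_differences[OF three, of E A] vanishE cardA by simp
      next
        case 3
        then show ?thesis
          using line_packing(2)[OF v(1) avoid] three card_three_dim[OF three] by simp
      qed
    qed
  qed
qed

text \<open>
  For the sizes 3 and 9 the spectrum is a line and a plane: a subgroup all of whose nonzero
  elements are zeros of \<open>fourier E\<close>, because \<open>fourier A\<close> does not vanish there.
\<close>

lemma spectral_if_tiles: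
  fixes E :: "('p::prime_card mod_ring ^ 3) set"
  assumes three: "CARD('p) = 3" and "E \<noteq> {}" and "tiles_by_translations E"
  shows "spectral E"
proof -
  obtain A where "\<forall>x. (\<Sum>a\<in>A. indicator E (x - a) :: nat) = 1"
    using assms(3) unfolding tiles_by_translations_def ..
  then have tile: "(\<Sum>a\<in>A. indicator E (x - a) :: nat) = 1" for x
    by (rule spec)
  have card: "card E * card A = 27"
    using card_tiling[OF tile] card_three_dim[OF three] by simp
  have zero: "fourier E m = 0 \<or> fourier A m = 0" if "m \<noteq> 0" for m
    using fourier_tiling[OF tile, of m] fourier_UNIV[OF that] by simp
  have "card E dvd 3 ^ 3"
    using dvd_triv_left[of "card E" "card A"] card by simp
  then obtain i where "i \<le> 3" "card E = 3 ^ i"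
    using divides_primepow_nat[of 3 "card E" 3] by auto
  moreover from this(1) have "i \<in> {0, 1, 2, 3}"
    by auto
  ultimately consider "card E = 1" | "card E = 3" | "card E = 9" | "card E = 27"
    by fastforce
  then show ?thesis
  proof cases
    case 1
    then show ?thesis
      using assms(2) by (intro spectralI[of "{0}"]) auto
  next
    case 2
    then have "card A = 9"
      using card by simp
    then have "A \<noteq> {}" "A \<noteq> UNIV"
      using card_three_dim[OF three] by auto
    then obtain m where m: "m \<noteq> 0" "fourier A m \<noteq> 0"
      by (rule exists_fourier_neq_0)
    then have "fourier E m = 0"
      using zero by blast
    then have "fourier E (a - b) = 0" if "a \<in> line m" "b \<in> line m" "a \<noteq> b" for a b
      using diff_in_line[OF that] fourier_scale[OF three] by metis
    then show ?thesis
      using 2 assms(2) m(1) three by (intro spectralI[of "line m"]) (auto simp: card_line)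
  next
    case 3
    then have A3: "card A = 3"
      using card by simp
    then obtain a b where ab: "a \<in> A" "b \<in> A" "a \<noteq> b"
      by (metis card_3_iff insertI1 insertI2)
    \<comment> \<open>A frequency orthogonal to \<open>a - b\<close> puts both points on the same level, whereas a zero of \<open>fourier A\<close>
      gives the three points of \<open>A\<close> distinct levels.\<close>
    let ?V = "{m. dot_prod m (a - b) = 0}"
    have "fourier UNIV (a - b) = 0"
      using ab by (intro fourier_UNIV) simp
    then have "3 * level UNIV (a - b) 0 = 27"
      unfolding fourier_eq_0_iff[OF three] card_three_dim[OF three] by blast
    then have "card ?V = 9"
      by (simp del: dot_prod_simps)
    moreover have "fourier E m = 0" if "m \<in> ?V" "m \<noteq> 0" for m
    proof (rule ccontr)
      assume "fourier E m \<noteq> 0"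
      then have "fourier A m = 0"
        using zero that by blast
      then have "3 * level A m (dot_prod a m) = 3"
        using A3 unfolding fourier_eq_0_iff[OF three] by simp
      then obtain c where "{x\<in>A. dot_prod x m = dot_prod a m} = {c}"
        by (auto simp: card_1_singleton_iff)
      moreover have "dot_prod b m = dot_prod a m"
        using that(1) by (simp add: dot_prod_commute)
      ultimately show False
        using ab by (metis (mono_tags, lifting) mem_Collect_eq singletonD)
    qed
    ultimately show ?thesis
      using 3 assms(2) by (intro spectralI[of ?V]) auto
  next
    case 4
    then have "E = UNIV"
      using card_three_dim[OF three] by (intro card_subset_eq) simp_all
    then show ?thesis
      by (intro spectralI[of UNIV]) (auto simp: fourier_UNIV)
  qed
qed

theorem corollary4:
  fixes E :: "('p::prime_card mod_ring ^ 3) set"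
  assumes "CARD('p) = 3" and "E \<noteq> {}"
  shows "spectral E \<longleftrightarrow> tiles_by_translations E"
  using tiles_if_spectral[OF assms] spectral_if_tiles[OF assms] by blast

end
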